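(* Suppose that $\mathfrak{g}$ has a simply-laced Dynkin diagram (that is, $\mathfrak{g}$ is of type $A_\ell$, $D_\ell$ or $E_\ell$), and let $m>1$ be an integer. Then $\mathcal{Y}_m^{r_i}=\mathcal{Z}_m^{(i)}$ for every $i\in I$. Consequently, $\mathcal{Y}_m^{W}=\bigcap_{i\in I}\mathcal{Z}_m^{(i)}$.
   Context: $\mathfrak g$ is a finite-dimensional simple Lie algebra over $\mathbb{C}$ of rank $\ell$, of type $A_\ell$, $D_\ell$ ($\ell\ge4$) or $E_\ell$ ($\ell=6,7,8$), $I=\{1,\dots,\ell\}$, with Cartan matrix $(C_{ij})$. Dynkin labelling: $A_\ell$ is the chain $1,\dots,\ell$; in $D_\ell$ the vertices $1,\dots,\ell-1$ form a chain and $\ell$ is attached to $\ell-2$; in $E_\ell$ the vertices $1,2,3,5,\dots,\ell$ form a chain and $4$ is attached to $3$. For $j\neq i$, $C_{ij}\ne0$ iff $i,j$ are adjacent. $\mathcal{Y}_m=\mathbb{C}(y_i(n);\,i\in I,\,n\in\mathbb{Z}/m\mathbb{Z})$ is the rational function field in independent commuting variables. For $(i,n)\in I\times\mathbb{Z}/m\mathbb{Z}$ set $$F_i(n)=\prod_{j<i,\,C_{ij}\ne0}y_j(n+1)\prod_{j>i,\,C_{ij}\neq0}y_j(n),\quad X_i(n)=\frac{F_i(n)}{y_i(n)y_i(n+1)},\quad P_i(n)=1+\sum_{k=0}^{m-2}X_i(n)X_i(n-1)\cdots X_i(n-k).$$ The Weyl group $W$ of $\mathfrak g$, generated by the simple reflections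 $r_i$ ($i\in I$), acts on $\mathcal{Y}_m$ by $\mathbb{C}$-algebra automorphisms determined by (known to be a well-defined $W$-action) $$r_i(y_i(n))=\frac{P_i(n-2)}{P_i(n-1)}\,y_i(n)X_i(n-1),\qquad r_i(y_j(n))=y_j(n)\ (j\neq i).$$ $\mathcal{Y}_m^{r_i}$ and $\mathcal{Y}_m^W$ are the subfields of $r_i$-invariants and $W$-invariants. Put $z_i(n)=y_i(n)+F_i(n)/y_i(n+1)$ and $\mathcal{Z}_m^{(i)}=\mathbb{C}(z_i(n),y_j(n);\,j\in I\setminus\{i\},\,n\in\mathbb{Z}/m\mathbb{Z})\subset\mathcal{Y}_m$. *)

theory Defs
  imports
    "HOL-Library.Poly_Mapping"
    "HOL-Library.Product_Lexorder"
    "HOL-Computational_Algebra.Fraction_Field"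
    "HOL-Algebra.Group_Action"
    "HOL-Algebra.Generated_Groups"
    "HOL-Algebra.Generated_Fields"
    "HOL-Algebra.Algebraic_Closure_Type"
begin

section \<open>Simply-laced Dynkin diagrams\<close>

datatype dynkin = TypeA nat | TypeD nat | TypeE nat

fun rank :: "dynkin \<Rightarrow> nat" where
  "rank (TypeA l) = l"
| "rank (TypeD l) = l"
| "rank (TypeE l) = l"

fun valid_dynkin :: "dynkin \<Rightarrow> bool" where
  "valid_dynkin (TypeA l) \<longleftrightarrow> l \<ge> 1"
| "valid_dynkin (TypeD l) \<longleftrightarrow> l \<ge> 4"
| "valid_dynkin (TypeE l) \<longleftrightarrow> l \<in> {6, 7, 8}"

definition nodes :: "dynkin \<Rightarrow> nat set" where
  "nodes t = {1..rank t}"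

text \<open>Each edge is listed once, as a pair with the smaller vertex first.  In type E the vertices
  1, 2, 3, 5, ..., l form the chain and 4 is attached to 3.\<close>

fun dynkin_edges :: "dynkin \<Rightarrow> (nat \<times> nat) set" where
  "dynkin_edges (TypeA l) = {(k, k + 1) | k. 1 \<le> k \<and> k + 1 \<le> l}"
| "dynkin_edges (TypeD l) = {(k, k + 1) | k. 1 \<le> k \<and> k + 1 \<le> l - 1} \<union> {(l - 2, l)}"
| "dynkin_edges (TypeE l) =
     {(1, 2), (2, 3), (3, 5), (3, 4)} \<union> {(k, k + 1) | k. 5 \<le> k \<and> k + 1 \<le> l}"

definition cartan :: "dynkin \<Rightarrow> nat \<Rightarrow> nat \<Rightarrow> int" where
  "cartan t i j =
     (if i = j then 2
      else if (i, j) \<in> dynkin_edges t \<or> (j, i) \<in> dynkin_edges t then -1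
      else 0)"

section \<open>The Weyl group\<close>

text \<open>The dual Cartan subalgebra, in coordinates with respect to the simple roots:
  \<open>v\<close> stands for the sum of the \<open>v k\<close> times the \<open>k\<close>-th simple root.\<close>

definition cartan_dual :: "dynkin \<Rightarrow> (nat \<Rightarrow> complex) set" where
  "cartan_dual t = (nodes t \<rightarrow>\<^sub>E UNIV)"

definition simple_reflection :: "dynkin \<Rightarrow> nat \<Rightarrow> (nat \<Rightarrow> complex) \<Rightarrow> (nat \<Rightarrow> complex)" where
  "simple_reflection t i =
     (\<lambda>v \<in> cartan_dual t. \<lambda>j \<in> nodes t.
        if j = i then v i - (\<Sum>k\<in>nodes t. of_int (cartan t i k) * v k) else v j)"

definition weyl_group :: "dynkin \<Rightarrow> ((nat \<Rightarrow> complex) \<Rightarrow> (nat \<Rightarrow> complex)) monoid" where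
  "weyl_group t =
     subgroup_generated (BijGroup (cartan_dual t)) (simple_reflection t ` nodes t)"

section \<open>The rational function field\<close>

text \<open>Rational functions over the complex numbers in independent variables indexed by all pairs
  in \<open>nat \<times> int\<close>: the fraction field of the polynomial ring, whose elements are finitely
  supported maps from monomials to coefficients.  The fields defined below are subfields of this
  one.  (The lexicographic order on the index pairs is only needed for the type class instance
  saying that the polynomial ring is an integral domain.)\<close>

type_synonym ratfun = "(((nat \<times> int) \<Rightarrow>\<^sub>0 nat) \<Rightarrow>\<^sub>0 complex) fract"

definition const_fun :: "complex \<Rightarrow> ratfun" where
  "const_fun c = Fraction_Field.Fract (Poly_Mapping.single 0 c) 1"

text \<open>The variable \<open>y\<^sub>i(n)\<close>, where \<open>n\<close> is read modulo \<open>m\<close>.\<close>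

definition y_var :: "nat \<Rightarrow> nat \<Rightarrow> int \<Rightarrow> ratfun" where
  "y_var m i n = Fraction_Field.Fract
     (Poly_Mapping.single (Poly_Mapping.single (i, n mod int m) 1) 1) 1"

text \<open>The subfield generated by the complex numbers and a set of rational functions.\<close>

definition adjoin :: "ratfun set \<Rightarrow> ratfun set" where
  "adjoin S = generate_field ring_of_type_algebra (range const_fun \<union> S)"

definition Y_field :: "dynkin \<Rightarrow> nat \<Rightarrow> ratfun set" where
  "Y_field t m = adjoin {y_var m i n | i n. i \<in> nodes t}"

definition F_mon :: "dynkin \<Rightarrow> nat \<Rightarrow> nat \<Rightarrow> int \<Rightarrow> ratfun" where
  "F_mon t m i n =
     (\<Prod>j | j \<in> nodes t \<and> j < i \<and> cartan t i j \<noteq> 0. y_var m j (n + 1)) *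
     (\<Prod>j | j \<in> nodes t \<and> j > i \<and> cartan t i j \<noteq> 0. y_var m j n)"

definition X_mon :: "dynkin \<Rightarrow> nat \<Rightarrow> nat \<Rightarrow> int \<Rightarrow> ratfun" where
  "X_mon t m i n = F_mon t m i n / (y_var m i n * y_var m i (n + 1))"

definition P_sum :: "dynkin \<Rightarrow> nat \<Rightarrow> nat \<Rightarrow> int \<Rightarrow> ratfun" where
  "P_sum t m i n = 1 + (\<Sum>k=0..m-2. \<Prod>s=0..k. X_mon t m i (n - int s))"

definition z_elt :: "dynkin \<Rightarrow> nat \<Rightarrow> nat \<Rightarrow> int \<Rightarrow> ratfun" where
  "z_elt t m i n = y_var m i n + F_mon t m i n / y_var m i (n + 1)"

definition Z_field :: "dynkin \<Rightarrow> nat \<Rightarrow> nat \<Rightarrow> ratfun set" where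
  "Z_field t m i =
     adjoin ({z_elt t m i n | n. True} \<union> {y_var m j n | j n. j \<in> nodes t - {i}})"

section \<open>The Weyl group action\<close>

text \<open>Maps on \<open>Y_field\<close> are normalised to be \<open>undefined\<close> outside it, as in \<open>BijGroup\<close>.\<close>

definition algebra_aut :: "dynkin \<Rightarrow> nat \<Rightarrow> (ratfun \<Rightarrow> ratfun) \<Rightarrow> bool" where
  "algebra_aut t m \<phi> \<longleftrightarrow>
     \<phi> \<in> extensional (Y_field t m) \<and>
     \<phi> \<in> ring_iso (ring_of_type_algebra\<lparr>carrier := Y_field t m\<rparr>)
                 (ring_of_type_algebra\<lparr>carrier := Y_field t m\<rparr>) \<and>
     (\<forall>c. \<phi> (const_fun c) = const_fun c)"

text \<open>The automorphism \<open>r\<^sub>i\<close> is the one determined by its values on the variables, which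
  generate the field.\<close>

definition r_aut :: "dynkin \<Rightarrow> nat \<Rightarrow> nat \<Rightarrow> ratfun \<Rightarrow> ratfun" where
  "r_aut t m i =
     (THE \<phi>. algebra_aut t m \<phi> \<and>
        (\<forall>n. \<phi> (y_var m i n) =
           P_sum t m i (n - 2) / P_sum t m i (n - 1) * y_var m i n * X_mon t m i (n - 1)) \<and>
        (\<forall>j \<in> nodes t - {i}. \<forall>n. \<phi> (y_var m j n) = y_var m j n))"

text \<open>An action of the Weyl group by algebra automorphisms in which the simple reflections act by
  the \<open>r\<^sub>i\<close>.  There is at most one, since the simple reflections generate the group.\<close>

definition weyl_action ::
    "dynkin \<Rightarrow> nat \<Rightarrow> (((nat \<Rightarrow> complex) \<Rightarrow> (nat \<Rightarrow> complex)) \<Rightarrow> ratfun \<Rightarrow> ratfun) \<Rightarrow> bool" where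
  "weyl_action t m \<rho> \<longleftrightarrow>
     group_action (weyl_group t) (Y_field t m) \<rho> \<and>
     (\<forall>w \<in> carrier (weyl_group t). algebra_aut t m (\<rho> w)) \<and>
     (\<forall>i \<in> nodes t. \<rho> (simple_reflection t i) = r_aut t m i)"

end

theory Submission
  imports Defs
begin

text \<open>Fix a node \<open>i\<close> and write \<open>y(n)\<close>, \<open>F(n)\<close>, \<open>X(n)\<close>, \<open>P(n)\<close>, \<open>z(n)\<close> without the index \<open>i\<close>; let
  \<open>Q\<close> be the product of all \<open>X(n)\<close>.  From \<open>X(n) P(n-1) = P(n) - 1 + Q\<close> one computes that the
  substitution \<open>r\<^sub>i\<close> is an involution (whence it extends to the field of fractions: a polynomial in the
  kernel would be sent to 0 by the identity) and that it fixes all \<open>z(n)\<close>.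

  Since \<open>y(n) = z(n) - F(n) / y(n+1)\<close>, going once around the cycle exhibits \<open>(y(0), 1)\<close> as an
  eigenvector of a 2 by 2 matrix over \<open>Z_field\<close>, with eigenvalue the product \<open>\<Lambda>\<close> of all \<open>y(n)\<close>.  But
  \<open>r\<^sub>i \<Lambda> = Q \<Lambda>\<close> differs from \<open>\<Lambda>\<close>, so \<open>\<Lambda>\<close> is not in \<open>Z_field\<close>, hence the lower left entry of the matrix is
  not 0, \<open>y(0)\<close> is an affine function of \<open>\<Lambda>\<close>, and \<open>Y_field = Z_field + Z_field \<Lambda>\<close>.  An
  element \<open>p + q \<Lambda>\<close> is therefore \<open>r\<^sub>i\<close>-invariant only if \<open>q = 0\<close>.\<close>

section \<open>Substitution into polynomials and rational functions\<close>

text \<open>Serves polynomials, as sums of terms, and equally exponent vectors, which are finitely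
  supported maps too.\<close>

lemma poly_mapping_additive_induct [case_names zero single add]:
  fixes p :: "'a \<Rightarrow>\<^sub>0 'b::comm_monoid_add"
  assumes "P 0" and "\<And>k a. P (Poly_Mapping.single k a)" and "\<And>f g. P f \<Longrightarrow> P g \<Longrightarrow> P (f + g)"
  shows "P p"
proof -
  have "p = (\<Sum>k\<in>Poly_Mapping.keys p. Poly_Mapping.single k (Poly_Mapping.lookup p k))"
    by (rule poly_mapping_eqI)
      (simp add: lookup_sum lookup_single when_def in_keys_iff)
  moreover have "finite A \<Longrightarrow> P (\<Sum>k\<in>A. Poly_Mapping.single k (Poly_Mapping.lookup p k))" for A
    by (induction A rule: finite_induct) (simp_all add: assms)
  ultimately show ?thesis
    using finite_keys by metis
qed

definition monomial_value :: "('v \<Rightarrow> 'k::field) \<Rightarrow> ('v \<Rightarrow>\<^sub>0 nat) \<Rightarrow> 'k" where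
  "monomial_value s \<mu> = (\<Prod>v\<in>Poly_Mapping.keys \<mu>. s v ^ Poly_Mapping.lookup \<mu> v)"

lemma monomial_value_superset:
  assumes "finite A" "Poly_Mapping.keys \<mu> \<subseteq> A"
  shows "monomial_value s \<mu> = (\<Prod>v\<in>A. s v ^ Poly_Mapping.lookup \<mu> v)"
  unfolding monomial_value_def
  by (rule prod.mono_neutral_left) (use assms in \<open>auto simp: in_keys_iff\<close>)

lemma monomial_value_zero [simp]: "monomial_value s 0 = 1"
  by (simp add: monomial_value_def)

lemma monomial_value_single [simp]: "monomial_value s (Poly_Mapping.single v n) = s v ^ n"
  by (simp add: monomial_value_def)

lemma monomial_value_add: "monomial_value s (\<mu> + \<nu>) = monomial_value s \<mu> * monomial_value s \<nu>"
proof -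
  let ?A = "Poly_Mapping.keys \<mu> \<union> Poly_Mapping.keys \<nu>"
  have "Poly_Mapping.keys (\<mu> + \<nu>) \<subseteq> ?A"
    by (rule keys_add)
  then have "monomial_value s (\<mu> + \<nu>) = (\<Prod>v\<in>?A. s v ^ Poly_Mapping.lookup (\<mu> + \<nu>) v)"
    by (intro monomial_value_superset) auto
  also have "\<dots> = (\<Prod>v\<in>?A. s v ^ Poly_Mapping.lookup \<mu> v) * (\<Prod>v\<in>?A. s v ^ Poly_Mapping.lookup \<nu> v)"
    by (simp add: lookup_add power_add prod.distrib)
  also have "\<dots> = monomial_value s \<mu> * monomial_value s \<nu>"
    by (simp add: monomial_value_superset[of ?A])
  finally show ?thesis .
qed

text \<open>Two instances occur: evaluation at complex numbers, which detects non-vanishing, and the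
  reflection, whose values are rational functions.\<close>

locale substitution =
  fixes c :: "'a::idom \<Rightarrow> 'k::field" and s :: "'v::linorder \<Rightarrow> 'k"
  assumes c_zero: "c 0 = 0" and c_one: "c 1 = 1"
    and c_add: "c (a + b) = c a + c b" and c_mult: "c (a * b) = c a * c b"
begin

definition subst :: "(('v \<Rightarrow>\<^sub>0 nat) \<Rightarrow>\<^sub>0 'a) \<Rightarrow> 'k" where
  "subst p = (\<Sum>\<mu>\<in>Poly_Mapping.keys p. c (Poly_Mapping.lookup p \<mu>) * monomial_value s \<mu>)"

lemma subst_zero [simp]: "subst 0 = 0"
  by (simp add: subst_def)

lemma subst_single [simp]: "subst (Poly_Mapping.single \<mu> a) = c a * monomial_value s \<mu>"
  by (simp add: subst_def c_zero)

lemma subst_one [simp]: "subst 1 = 1"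
  using subst_single[of 0 1] by (simp add: c_one)

lemma subst_add [simp]: "subst (p + q) = subst p + subst q"
  unfolding subst_def by (rule setsum_keys_plus_distrib) (simp_all add: c_zero c_add algebra_simps)

lemma subst_mult [simp]: "subst (p * q) = subst p * subst q"
proof (induction p rule: poly_mapping_additive_induct)
  case (single \<mu> a)
  show ?case
    by (induction q rule: poly_mapping_additive_induct)
      (simp_all add: mult_single monomial_value_add c_mult algebra_simps)
qed (simp_all add: algebra_simps)

lemma subst_uminus [simp]: "subst (- p) = - subst p"
  by (metis add.right_inverse eq_neg_iff_add_eq_0 add.commute subst_add subst_zero)

text \<open>The polynomials with nonzero value are inverted, so this is the substitution homomorphism on
  the localisation of the polynomial ring at its kernel.\<close>

definition specializes :: "(('v \<Rightarrow>\<^sub>0 nat) \<Rightarrow>\<^sub>0 'a) fract \<Rightarrow> 'k \<Rightarrow> bool" where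
  "specializes x u \<longleftrightarrow>
     (\<exists>p q. subst q \<noteq> 0 \<and> x = Fraction_Field.Fract p q \<and> u = subst p / subst q)"

lemma specializesE:
  assumes "specializes x u"
  obtains p q where "q \<noteq> 0" "subst q \<noteq> 0" "x = Fraction_Field.Fract p q" "u = subst p / subst q"
  using assms unfolding specializes_def by (metis subst_zero)

lemma specializes_Fract:
  "subst q \<noteq> 0 \<Longrightarrow> specializes (Fraction_Field.Fract p q) (subst p / subst q)"
  unfolding specializes_def by blast

lemma specializes_poly: "specializes (Fraction_Field.Fract p 1) (subst p)"
  using specializes_Fract[of 1 p] by simp

lemma specializes_unique:
  assumes "specializes x u" "specializes x v"
  shows "u = v"
proof -
  obtain p q p' q' where *: "q \<noteq> 0" "subst q \<noteq> 0" "q' \<noteq> 0" "subst q' \<noteq> 0"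
      "u = subst p / subst q" "v = subst p' / subst q'"
      "Fraction_Field.Fract p q = Fraction_Field.Fract p' q'"
    using assms by (metis specializesE)
  then have "subst (p * q') = subst (p' * q)"
    by (simp add: eq_fract)
  with * show ?thesis
    by (simp add: frac_eq_eq)
qed

lemma specializes_zero: "specializes 0 0"
  using specializes_poly[of 0] by (simp add: Zero_fract_def)

lemma specializes_one: "specializes 1 1"
  using specializes_poly[of 1] by (simp add: One_fract_def)

lemma specializes_add:
  assumes "specializes x u" "specializes y v"
  shows "specializes (x + y) (u + v)"
proof -
  obtain p q p' q' where *: "q \<noteq> 0" "subst q \<noteq> 0" "q' \<noteq> 0" "subst q' \<noteq> 0"
      "u = subst p / subst q" "v = subst p' / subst q'"
      "x = Fraction_Field.Fract p q" "y = Fraction_Field.Fract p' q'"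
    using assms by (metis specializesE)
  then have "specializes (x + y) (subst (p * q' + p' * q) / subst (q * q'))"
    using specializes_Fract[of "q * q'" "p * q' + p' * q"] by simp
  with * show ?thesis
    by (simp add: add_frac_eq)
qed

lemma specializes_mult:
  assumes "specializes x u" "specializes y v"
  shows "specializes (x * y) (u * v)"
proof -
  obtain p q p' q' where *: "subst q \<noteq> 0" "subst q' \<noteq> 0"
      "u = subst p / subst q" "v = subst p' / subst q'"
      "x = Fraction_Field.Fract p q" "y = Fraction_Field.Fract p' q'"
    using assms by (metis specializesE)
  then show ?thesis
    using specializes_Fract[of "q * q'" "p * p'"] by simp
qed

lemma specializes_uminus:
  assumes "specializes x u"
  shows "specializes (- x) (- u)"
proof -
  obtain p q where "subst q \<noteq> 0" "u = subst p / subst q" "x = Fraction_Field.Fract p q"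
    using assms by (metis specializesE)
  then show ?thesis
    using specializes_Fract[of q "- p"] by simp
qed

lemma specializes_inverse:
  assumes "specializes x u" "u \<noteq> 0"
  shows "specializes (inverse x) (inverse u)"
proof -
  obtain p q where "subst q \<noteq> 0" "u = subst p / subst q" "x = Fraction_Field.Fract p q"
    using assms by (metis specializesE)
  then show ?thesis
    using specializes_Fract[of p q] assms(2) by simp
qed

lemma specializes_divide:
  "specializes x u \<Longrightarrow> specializes y v \<Longrightarrow> v \<noteq> 0 \<Longrightarrow> specializes (x / y) (u / v)"
  by (simp add: divide_inverse specializes_mult specializes_inverse)

lemma specializes_sum:
  "(\<And>k. k \<in> A \<Longrightarrow> specializes (f k) (g k)) \<Longrightarrow> specializes (sum f A) (sum g A)"
  by (induction A rule: infinite_finite_induct) (auto intro: specializes_zero specializes_add)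

lemma specializes_prod:
  "(\<And>k. k \<in> A \<Longrightarrow> specializes (f k) (g k)) \<Longrightarrow> specializes (prod f A) (prod g A)"
  by (induction A rule: infinite_finite_induct) (auto intro: specializes_one specializes_mult)

lemma specializes_power: "specializes x u \<Longrightarrow> specializes (x ^ n) (u ^ n)"
  by (induction n) (auto intro: specializes_one specializes_mult)

text \<open>0 specializes to 0 and values are unique. A nonzero value at a single point thus proves
  that a rational function does not vanish.\<close>

lemma specializes_nonzero: "specializes x u \<Longrightarrow> u \<noteq> 0 \<Longrightarrow> x \<noteq> 0"
  using specializes_zero specializes_unique by blast

lemma specializes_variable:
  "specializes (Fraction_Field.Fract (Poly_Mapping.single (Poly_Mapping.single v 1) 1) 1) (s v)"
  using specializes_poly[of "Poly_Mapping.single (Poly_Mapping.single v 1) 1"] by (simp add: c_one)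

lemma specializes_constant:
  "specializes (Fraction_Field.Fract (Poly_Mapping.single 0 a) 1) (c a)"
  using specializes_poly[of "Poly_Mapping.single 0 a"] by simp

end


section \<open>Periodic sequences\<close>

definition cyclic_prod :: "nat \<Rightarrow> (int \<Rightarrow> 'k::field) \<Rightarrow> int \<Rightarrow> 'k" where
  "cyclic_prod m x n = (\<Prod>s<m. x (n - int s))"

text \<open>With \<open>X_mon\<close> for \<open>x\<close> and \<open>m > 1\<close> this is
  \<open>P_sum\<close>: the empty product, at \<open>k = 0\<close>, supplies the leading 1.\<close>

definition partial_prod_sum :: "nat \<Rightarrow> (int \<Rightarrow> 'k::field) \<Rightarrow> int \<Rightarrow> 'k" where
  "partial_prod_sum m x n = (\<Sum>k<m. \<Prod>s<k. x (n - int s))"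

text \<open>Moving the window down by one replaces the factor \<open>x n\<close> by
  \<open>x (n - int m)\<close>, which is equal to it.\<close>

lemma cyclic_prod_step:
  assumes "m > 0" "\<And>n. x (n - int m) = x n"
  shows "cyclic_prod m x (n - 1) = cyclic_prod m x n"
proof -
  obtain l where l: "m = Suc l"
    using \<open>m > 0\<close> gr0_implies_Suc by blast
  have "cyclic_prod m x (n - 1) = (\<Prod>s<l. x (n - 1 - int s)) * x (n - int m)"
    by (simp add: cyclic_prod_def l algebra_simps)
  also have "\<dots> = x n * (\<Prod>s<l. x (n - int (Suc s)))"
    by (simp add: assms(2) algebra_simps)
  also have "\<dots> = cyclic_prod m x n"
    unfolding cyclic_prod_def l prod.lessThan_Suc_shift by simp
  finally show ?thesis .
qed

lemma cyclic_prod_const: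
  assumes "m > 0" "\<And>n. x (n - int m) = x n"
  shows "cyclic_prod m x n = cyclic_prod m x 0"
proof (induction n rule: int_induct[where k = 0])
  case (step1 i)
  with cyclic_prod_step[where x = x, OF assms, of "i + 1"] show ?case by simp
next
  case (step2 i)
  with cyclic_prod_step[where x = x, OF assms, of i] show ?case by simp
qed simp

lemma cyclic_prod_shift:
  assumes "m > 0" "\<And>n. x (n - int m) = x n"
  shows "cyclic_prod m (\<lambda>n. x (n - k)) n = cyclic_prod m x n"
proof -
  have "cyclic_prod m (\<lambda>n. x (n - k)) n = cyclic_prod m x (n - k)"
    by (simp add: cyclic_prod_def algebra_simps)
  with cyclic_prod_const[where x = x, OF assms] show ?thesis by metis
qed

text \<open>Multiplication by \<open>x n\<close> lengthens every product by one factor: the empty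
  product is lost and the full cyclic product is gained.\<close>

lemma partial_prod_sum_rec:
  assumes "m > 0"
  shows "x n * partial_prod_sum m x (n - 1) = partial_prod_sum m x n - 1 + cyclic_prod m x n"
proof -
  have "x n * (\<Prod>s<k. x (n - 1 - int s)) = (\<Prod>s<Suc k. x (n - int s))" for k
    unfolding prod.lessThan_Suc_shift by (simp add: algebra_simps)
  then have "x n * partial_prod_sum m x (n - 1) = (\<Sum>k<m. \<Prod>s<Suc k. x (n - int s))"
    unfolding partial_prod_sum_def sum_distrib_left by (rule sum.cong[OF refl])
  then have "1 + x n * partial_prod_sum m x (n - 1) = (\<Sum>k<Suc m. \<Prod>s<k. x (n - int s))"
    unfolding sum.lessThan_Suc_shift by simp
  then show ?thesis
    by (simp add: partial_prod_sum_def cyclic_prod_def algebra_simps)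
qed

text \<open>The difference \<open>d\<close> of two periodic solutions satisfies
  \<open>d n = x n * d (n - 1)\<close>. One turn around the cycle multiplies it by the cyclic
  product, which is not 1, so \<open>d\<close> vanishes. This allows the reflected \<open>P\<close>
  to be found without expanding sums.\<close>

lemma partial_prod_sum_unique:
  assumes "m > 0" "\<And>n. x (n - int m) = x n" "\<And>n. p (n - int m) = p n" "cyclic_prod m x 0 \<noteq> 1"
    and rec: "\<And>n. x n * p (n - 1) = p n - 1 + cyclic_prod m x 0"
  shows "p n = partial_prod_sum m x n"
proof -
  have cyclic: "cyclic_prod m x n = cyclic_prod m x 0" for n
    by (rule cyclic_prod_const) (rule assms)+
  define d where "d n = p n - partial_prod_sum m x n" for n
  have d_rec: "d n = x n * d (n - 1)" for n
    unfolding d_def right_diff_distrib rec partial_prod_sum_rec[OF \<open>m > 0\<close>]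
    by (simp add: cyclic[of n])
  have "d n = (\<Prod>s<k. x (n - int s)) * d (n - int k)" for k
  proof (induction k)
    case (Suc k)
    then show ?case
      using d_rec[of "n - int k"] by (simp add: algebra_simps)
  qed simp
  from this[of m] have "d n = cyclic_prod m x n * d (n - int m)"
    by (simp add: cyclic_prod_def)
  moreover have "d (n - int m) = d n"
  proof -
    have "x (n - int m - int s) = x (n - int s)" for s
      using assms(2)[of "n - int s"] by (simp add: algebra_simps)
    then show ?thesis
      by (simp add: d_def assms(3) partial_prod_sum_def)
  qed
  moreover have "cyclic_prod m x n \<noteq> 1"
    using assms(4) by (simp add: cyclic[of n])
  ultimately have "d n = 0"
    by (metis mult_cancel_right1)
  then show ?thesis
    by (simp add: d_def)
qed

section \<open>Reflection formulas for periodic sequences in a field\<close>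

locale cyclic_system =
  fixes m :: nat and y F :: "int \<Rightarrow> 'k::field"
  assumes m_pos: "m > 0"
    and y_periodic: "\<And>n. y (n - int m) = y n" and F_periodic: "\<And>n. F (n - int m) = F n"
    and y_nonzero: "\<And>n. y n \<noteq> 0" and F_nonzero: "\<And>n. F n \<noteq> 0"
begin

definition x :: "int \<Rightarrow> 'k" where "x n = F n / (y n * y (n + 1))"
definition P :: "int \<Rightarrow> 'k" where "P n = partial_prod_sum m x n"
definition Q :: 'k where "Q = cyclic_prod m x 0"
text \<open>\<open>ry\<close> and \<open>rx\<close> are the intended images of \<open>y\<close> and
  \<open>x\<close> under the reflection, written as field elements before any automorphism is
  available. \<open>rx\<close> keeps \<open>F\<close> because in the application \<open>F\<close>
  contains only variables of other nodes.\<close>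

definition ry :: "int \<Rightarrow> 'k" where "ry n = P (n - 2) / P (n - 1) * y n * x (n - 1)"
definition rx :: "int \<Rightarrow> 'k" where "rx n = F n / (ry n * ry (n + 1))"

lemma x_periodic: "x (n - int m) = x n"
  using y_periodic[of "n + 1"] y_periodic[of n] F_periodic[of n]
  by (simp add: x_def algebra_simps)

lemma x_nonzero: "x n \<noteq> 0"
  by (simp add: x_def y_nonzero F_nonzero)

lemma Q_eq: "cyclic_prod m x n = Q"
  unfolding Q_def by (rule cyclic_prod_const) (simp_all add: m_pos x_periodic)

lemma P_periodic: "P (n - int m) = P n"
proof -
  have "x (n - int m - int s) = x (n - int s)" for s
    using x_periodic[of "n - int s"] by (simp add: algebra_simps)
  then show ?thesis
    by (simp add: P_def partial_prod_sum_def)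
qed

lemma P_rec: "x n * P (n - 1) = P n - 1 + Q"
  unfolding P_def partial_prod_sum_rec[OF m_pos] Q_eq ..

end

locale reflected_system = cyclic_system +
  assumes P_nonzero: "\<And>n. P n \<noteq> 0" and Q_not_one: "Q \<noteq> 1"
begin

lemma Q_nonzero: "Q \<noteq> 0"
  by (simp add: Q_def cyclic_prod_def x_nonzero)

lemma ry_nonzero: "ry n \<noteq> 0"
  by (simp add: ry_def P_nonzero x_nonzero y_nonzero)

lemma ry_altdef: "ry n = P (n - 2) / P (n - 1) * F (n - 1) / y (n - 1)"
  using y_nonzero[of n] by (simp add: ry_def x_def field_simps)

lemma ry_altdef': "ry (n + 1) = P (n - 1) / P n * F n / y n"
  using ry_altdef[of "n + 1"] by simp

text \<open>The factors \<open>P (n - 1)\<close> and \<open>F n\<close> cancel. In the product of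
  this expression over a period the \<open>P\<close> cancel as well, leaving the inverse of
  \<open>Q\<close>.\<close>

lemma rx_eq: "rx n = P n / (P (n - 2) * x (n - 1))"
  using y_nonzero[of n] y_nonzero[of "n + 1"] y_nonzero[of "n - 1"] F_nonzero[of n] F_nonzero[of "n - 1"]
    P_nonzero[of n] P_nonzero[of "n - 2"] P_nonzero[of "n - 1"]
  unfolding rx_def ry_altdef[of n] ry_altdef'[of n] x_def by (simp add: field_simps)

lemma cyclic_prod_rx: "cyclic_prod m rx n = inverse Q"
proof -
  have "cyclic_prod m rx n =
      cyclic_prod m P n / (cyclic_prod m (\<lambda>n. P (n - 2)) n * cyclic_prod m (\<lambda>n. x (n - 1)) n)"
    by (simp add: cyclic_prod_def rx_eq prod_dividef prod.distrib)
  also have "\<dots> = cyclic_prod m P n / (cyclic_prod m P n * Q)"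
    using cyclic_prod_shift[of m P] cyclic_prod_shift[of m x]
    by (simp add: m_pos P_periodic x_periodic Q_eq)
  also have "\<dots> = inverse Q"
    by (simp add: cyclic_prod_def P_nonzero field_simps)
  finally show ?thesis .
qed

text \<open>By uniqueness it suffices to check the recurrence for \<open>rx\<close>; both of its
  sides reduce to \<open>P n / Q\<close>.\<close>

lemma partial_prod_sum_rx: "partial_prod_sum m rx n = P (n - 1) * x n / Q"
proof (rule partial_prod_sum_unique[symmetric])
  show "m > 0" by (rule m_pos)
  show "rx (n - int m) = rx n" for n
  proof -
    have "P (n - 2 - int m) = P (n - 2)" "x (n - 1 - int m) = x (n - 1)"
      by (rule P_periodic x_periodic)+
    then show ?thesis
      by (simp add: rx_eq P_periodic algebra_simps)
  qed
  show "P (n - int m - 1) * x (n - int m) / Q = P (n - 1) * x n / Q" for n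
    using P_periodic[of "n - 1"] by (simp add: x_periodic algebra_simps)
  show "cyclic_prod m rx 0 \<noteq> 1"
    using Q_not_one by (simp add: cyclic_prod_rx)
  show "rx n * (P (n - 1 - 1) * x (n - 1) / Q) = P (n - 1) * x n / Q - 1 + cyclic_prod m rx 0" for n
  proof -
    have "P (n - 1) * x n = P n - 1 + Q"
      using P_rec[of n] by (simp add: mult.commute)
    then have "P (n - 1) * x n / Q - 1 + cyclic_prod m rx 0 = P n / Q"
      using Q_nonzero unfolding cyclic_prod_rx by (simp add: field_simps)
    moreover have "rx n * (P (n - 1 - 1) * x (n - 1) / Q) = P n / Q"
      using P_nonzero[of "n - 2"] x_nonzero[of "n - 1"] by (simp add: rx_eq)
    ultimately show ?thesis by simp
  qed
qed

text \<open>The left side is the formula for \<open>ry\<close> with all its ingredients reflected,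
  so reflecting twice gives back \<open>y\<close>. All \<open>P\<close> cancel, and what is left is
  \<open>F (n - 1) / (y (n - 1) * x (n - 1))\<close>.\<close>

lemma ry_involution:
  "partial_prod_sum m rx (n - 2) / partial_prod_sum m rx (n - 1) * ry n * rx (n - 1) = y n"
proof -
  have x1: "x (n - 1) = F (n - 1) / (y (n - 1) * y n)"
    by (simp add: x_def)
  show ?thesis
    using P_nonzero[of "n - 1"] P_nonzero[of "n - 2"] P_nonzero[of "n - 3"] x_nonzero[of "n - 2"]
      y_nonzero[of n] y_nonzero[of "n - 1"] F_nonzero[of "n - 1"] Q_nonzero
    unfolding partial_prod_sum_rx rx_eq ry_altdef x1
    by (simp add: field_simps)
qed

text \<open>After multiplication by \<open>P (n - 1)\<close> the recurrence is applied at
  \<open>n - 1\<close> and then backwards at \<open>n\<close>; the term \<open>Q - 1\<close>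
  produced by the first use is absorbed by the second.\<close>

lemma ry_z: "ry n + F n / ry (n + 1) = y n + F n / y (n + 1)"
proof -
  have 1: "F n / ry (n + 1) = P n / P (n - 1) * y n"
    using y_nonzero[of n] F_nonzero[of n] P_nonzero[of n] P_nonzero[of "n - 1"]
    unfolding ry_altdef' by (simp add: field_simps)
  have "ry n * P (n - 1) = y n * (x (n - 1) * P (n - 2))"
    using P_nonzero[of "n - 1"] by (simp add: ry_def)
  also have "x (n - 1) * P (n - 2) = P (n - 1) - 1 + Q"
    using P_rec[of "n - 1"] by simp
  finally have "(ry n + F n / ry (n + 1)) * P (n - 1) = y n * (P (n - 1) - 1 + Q + P n)"
    using P_nonzero[of "n - 1"] unfolding 1 distrib_right by (simp add: field_simps)
  also have "\<dots> = y n * (P (n - 1) + x n * P (n - 1))"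
    by (simp add: P_rec)
  also have "\<dots> = (y n + F n / y (n + 1)) * P (n - 1)"
    using y_nonzero[of n] y_nonzero[of "n + 1"] by (simp add: x_def field_simps)
  finally show ?thesis
    using P_nonzero[of "n - 1"] by simp
qed

text \<open>The quotients of the \<open>P\<close> cancel over a period, so only the factors
  \<open>x\<close> contribute, and they give \<open>Q\<close>.\<close>

lemma cyclic_prod_ry: "cyclic_prod m ry n = Q * cyclic_prod m y n"
proof -
  have "cyclic_prod m ry n =
      cyclic_prod m (\<lambda>n. P (n - 2)) n / cyclic_prod m (\<lambda>n. P (n - 1)) n * cyclic_prod m y n *
      cyclic_prod m (\<lambda>n. x (n - 1)) n"
    by (simp add: cyclic_prod_def ry_def prod_dividef prod.distrib)
  also have "\<dots> = cyclic_prod m P n / cyclic_prod m P n * cyclic_prod m y n * Q"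
    using cyclic_prod_shift[of m P] cyclic_prod_shift[of m x]
    by (simp add: m_pos P_periodic x_periodic Q_eq)
  also have "\<dots> = Q * cyclic_prod m y n"
    by (simp add: cyclic_prod_def P_nonzero)
  finally show ?thesis .
qed

end


section \<open>Involutions of the rational function field\<close>

definition variable :: "'v::linorder \<Rightarrow> (('v \<Rightarrow>\<^sub>0 nat) \<Rightarrow>\<^sub>0 'a::idom) fract" where
  "variable v = Fraction_Field.Fract (Poly_Mapping.single (Poly_Mapping.single v 1) 1) 1"

lemma monomial_value_variable:
  fixes \<mu> :: "'v::linorder \<Rightarrow>\<^sub>0 nat"
  shows "monomial_value (variable :: 'v \<Rightarrow> (('v \<Rightarrow>\<^sub>0 nat) \<Rightarrow>\<^sub>0 'a::idom) fract) \<mu> = Fraction_Field.Fract (Poly_Mapping.single \<mu> 1) 1"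
proof (induction \<mu> rule: poly_mapping_additive_induct)
  case (single v n)
  show ?case
  proof (induction n)
    case (Suc n)
    have "monomial_value variable (Poly_Mapping.single v (Suc n)) =
        (variable v :: (('v \<Rightarrow>\<^sub>0 nat) \<Rightarrow>\<^sub>0 'a) fract) * monomial_value variable (Poly_Mapping.single v n)"
      by simp
    also have "\<dots> = Fraction_Field.Fract (Poly_Mapping.single (Poly_Mapping.single v (Suc n)) 1) 1"
      unfolding Suc.IH by (simp add: variable_def mult_single flip: single_add)
    finally show ?case .
  qed (simp add: One_fract_def)
qed (simp_all add: One_fract_def monomial_value_add mult_single)

text \<open>\<open>involutive\<close> says that substituting twice returns each variable. It is
  phrased with \<open>specializes\<close> because \<open>s v\<close> is a fraction whose denominator
  is not yet known to survive the substitution.\<close>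

locale involutive_substitution = substitution c s
  for c :: "'a::idom \<Rightarrow> (('v::linorder \<Rightarrow>\<^sub>0 nat) \<Rightarrow>\<^sub>0 'a) fract" and s :: "'v \<Rightarrow> (('v \<Rightarrow>\<^sub>0 nat) \<Rightarrow>\<^sub>0 'a) fract" +
  assumes c_eq: "c a = Fraction_Field.Fract (Poly_Mapping.single 0 a) 1"
    and involutive: "specializes (s v) (variable v)"
begin

lemma specializes_subst: "specializes (subst p) (Fraction_Field.Fract p 1)"
proof (induction p rule: poly_mapping_additive_induct)
  case zero
  then show ?case
    using specializes_zero by (simp add: Zero_fract_def)
next
  case (single \<mu> a)
  have "Fraction_Field.Fract (Poly_Mapping.single \<mu> a) 1 = c a * monomial_value variable \<mu>"
    by (simp add: c_eq monomial_value_variable mult_single)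
  moreover have "specializes (c a) (c a)"
    using specializes_constant by (simp add: c_eq)
  moreover have "specializes (monomial_value s \<mu>) (monomial_value variable \<mu>)"
    unfolding monomial_value_def by (intro specializes_prod specializes_power involutive)
  ultimately show ?case
    by (simp add: specializes_mult)
next
  case (add f g)
  then have "specializes (subst f + subst g) (Fraction_Field.Fract f 1 + Fraction_Field.Fract g 1)"
    by (rule specializes_add)
  then show ?case by simp
qed

text \<open>A second substitution recovers \<open>p\<close>, so the kernel is trivial. Hence no
  denominator is killed, every fraction specializes, and \<open>extension\<close> is total.\<close>

lemma subst_nonzero:
  assumes "p \<noteq> 0"
  shows "subst p \<noteq> 0"
proof
  assume "subst p = 0"
  with specializes_subst[of p] specializes_unique specializes_zero
  have "Fraction_Field.Fract p 1 = 0"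
    by metis
  with assms show False
    by (simp add: Zero_fract_def eq_fract)
qed

definition extension where "extension x = (THE u. specializes x u)"

lemma extension_eq: "specializes x u \<Longrightarrow> extension x = u"
  unfolding extension_def using specializes_unique by blast

lemma specializes_extension: "specializes x (extension x)"
proof -
  obtain p q where "x = Fraction_Field.Fract p q" "q \<noteq> 0"
    by (cases x) auto
  then have "specializes x (subst p / subst q)"
    using specializes_Fract subst_nonzero by blast
  then show ?thesis
    by (simp add: extension_eq)
qed

lemma extension_const [simp]: "extension (c a) = c a"
  using specializes_constant by (simp add: c_eq extension_eq)

lemma extension_add [simp]: "extension (x + y) = extension x + extension y"
  by (intro extension_eq specializes_add specializes_extension)

lemma extension_mult [simp]: "extension (x * y) = extension x * extension y"
  by (intro extension_eq specializes_mult specializes_extension)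

lemma extension_uminus [simp]: "extension (- x) = - extension x"
  by (intro extension_eq specializes_uminus specializes_extension)

lemma extension_zero [simp]: "extension 0 = 0"
  by (intro extension_eq specializes_zero)

lemma extension_one [simp]: "extension 1 = 1"
  by (intro extension_eq specializes_one)

lemma extension_prod: "extension (prod f A) = (\<Prod>a\<in>A. extension (f a))"
  by (intro extension_eq specializes_prod specializes_extension)

lemma extension_extension [simp]: "extension (extension x) = x"
proof (rule extension_eq)
  obtain p q where x: "x = Fraction_Field.Fract p q" "q \<noteq> 0"
    by (cases x) auto
  have "extension x = subst p / subst q"
    using x specializes_Fract subst_nonzero extension_eq by blast
  moreover have "specializes (subst p / subst q) (Fraction_Field.Fract p 1 / Fraction_Field.Fract q 1)"
    using x(2) by (intro specializes_divide specializes_subst) (simp add: Zero_fract_def eq_fract)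
  ultimately show "specializes (extension x) x"
    by (simp add: x)
qed

lemma extension_eq_0_iff [simp]: "extension x = 0 \<longleftrightarrow> x = 0"
  by (metis extension_extension extension_zero)

lemma extension_inverse [simp]: "extension (inverse x) = inverse (extension x)"
  by (cases "x = 0") (auto intro!: extension_eq specializes_inverse specializes_extension)

lemma extension_divide [simp]: "extension (x / y) = extension x / extension y"
  by (simp add: divide_inverse)

end

section \<open>Generated subfields\<close>

lemma ring_of_type_algebra_simps [simp]:
  "carrier (ring_of_type_algebra :: ratfun ring) = UNIV"
  "x \<otimes>\<^bsub>ring_of_type_algebra\<^esub> y = x * (y :: ratfun)"
  "x \<oplus>\<^bsub>ring_of_type_algebra\<^esub> y = x + (y :: ratfun)"
  "\<one>\<^bsub>ring_of_type_algebra\<^esub> = (1 :: ratfun)"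
  "\<zero>\<^bsub>ring_of_type_algebra\<^esub> = (0 :: ratfun)"
  by (simp_all add: ring_of_type_algebra_def)

lemma ring_of_type_algebra_uminus [simp]: "\<ominus>\<^bsub>ring_of_type_algebra\<^esub> x = - (x :: ratfun)"
proof -
  interpret cring "ring_of_type_algebra :: ratfun ring"
    by (rule cring_from_type_algebra)
  show ?thesis
    by (rule minus_equality) simp_all
qed

lemma ring_of_type_algebra_inverse [simp]:
  assumes "x \<noteq> 0"
  shows "inv\<^bsub>ring_of_type_algebra\<^esub> x = inverse (x :: ratfun)"
proof -
  interpret cring "ring_of_type_algebra :: ratfun ring"
    by (rule cring_from_type_algebra)
  show ?thesis
    by (rule comm_inv_char) (use assms in simp_all)
qed

lemma const_fun_zero [simp]: "const_fun 0 = 0"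
  by (simp add: const_fun_def Zero_fract_def)

lemma const_fun_one [simp]: "const_fun 1 = 1"
  by (simp add: const_fun_def One_fract_def)

lemma const_fun_add: "const_fun (a + b) = const_fun a + const_fun b"
  by (simp add: const_fun_def single_add)

lemma const_fun_mult: "const_fun (a * b) = const_fun a * const_fun b"
  by (simp add: const_fun_def mult_single)

lemma adjoin_const [intro, simp]: "const_fun c \<in> adjoin S"
  by (auto simp: adjoin_def intro: generate_field.incl)

lemma adjoin_incl [intro]: "x \<in> S \<Longrightarrow> x \<in> adjoin S"
  by (auto simp: adjoin_def intro: generate_field.incl)

lemma adjoin_zero [intro, simp]: "0 \<in> adjoin S"
  using adjoin_const[of 0] by simp

lemma adjoin_one [intro, simp]: "1 \<in> adjoin S"
  using adjoin_const[of 1] by simp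

lemma adjoin_add [intro]: "x \<in> adjoin S \<Longrightarrow> y \<in> adjoin S \<Longrightarrow> x + y \<in> adjoin S"
  using generate_field.eng_add[of x ring_of_type_algebra _ y] by (simp add: adjoin_def)

lemma adjoin_mult [intro]: "x \<in> adjoin S \<Longrightarrow> y \<in> adjoin S \<Longrightarrow> x * y \<in> adjoin S"
  using generate_field.eng_mult[of x ring_of_type_algebra _ y] by (simp add: adjoin_def)

lemma adjoin_uminus [intro]: "x \<in> adjoin S \<Longrightarrow> - x \<in> adjoin S"
  using generate_field.a_inv[of x ring_of_type_algebra] by (simp add: adjoin_def)

text \<open>The generation rule inverts nonzero elements only; at 0 the type class convention
  \<open>inverse 0 = 0\<close> stays in the field.\<close>

lemma adjoin_inverse [intro]: "x \<in> adjoin S \<Longrightarrow> inverse x \<in> adjoin S"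
  using generate_field.m_inv[of x ring_of_type_algebra] by (cases "x = 0") (auto simp: adjoin_def)

lemma adjoin_diff [intro]: "x \<in> adjoin S \<Longrightarrow> y \<in> adjoin S \<Longrightarrow> x - y \<in> adjoin S"
  using adjoin_add[OF _ adjoin_uminus] by fastforce

lemma adjoin_divide [intro]: "x \<in> adjoin S \<Longrightarrow> y \<in> adjoin S \<Longrightarrow> x / y \<in> adjoin S"
  by (simp add: divide_inverse adjoin_mult adjoin_inverse)

lemma adjoin_sum: "(\<And>a. a \<in> A \<Longrightarrow> f a \<in> adjoin S) \<Longrightarrow> sum f A \<in> adjoin S"
  by (induction A rule: infinite_finite_induct) auto

lemma adjoin_prod: "(\<And>a. a \<in> A \<Longrightarrow> f a \<in> adjoin S) \<Longrightarrow> prod f A \<in> adjoin S"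
  by (induction A rule: infinite_finite_induct) auto

lemma adjoin_induct [consumes 1, case_names const incl add mult uminus inverse]:
  assumes "x \<in> adjoin S"
    and "\<And>c. R (const_fun c)" and "\<And>x. x \<in> S \<Longrightarrow> R x"
    and "\<And>x y. x \<in> adjoin S \<Longrightarrow> y \<in> adjoin S \<Longrightarrow> R x \<Longrightarrow> R y \<Longrightarrow> R (x + y)"
    and "\<And>x y. x \<in> adjoin S \<Longrightarrow> y \<in> adjoin S \<Longrightarrow> R x \<Longrightarrow> R y \<Longrightarrow> R (x * y)"
    and "\<And>x. x \<in> adjoin S \<Longrightarrow> R x \<Longrightarrow> R (- x)"
    and "\<And>x. x \<in> adjoin S \<Longrightarrow> x \<noteq> 0 \<Longrightarrow> R x \<Longrightarrow> R (inverse x)"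
  shows "R x"
  using assms(1) unfolding adjoin_def
proof (induction rule: generate_field.induct)
  case one
  show ?case using assms(2)[of 1] by simp
qed (use assms(2-) in \<open>auto simp: adjoin_def\<close>)

lemma adjoin_subset: "S \<subseteq> adjoin T \<Longrightarrow> adjoin S \<subseteq> adjoin T"
proof
  fix x
  assume "S \<subseteq> adjoin T" "x \<in> adjoin S"
  then show "x \<in> adjoin T"
    by (induction rule: adjoin_induct[OF \<open>x \<in> adjoin S\<close>]) auto
qed


section \<open>The reflection automorphism\<close>

lemma periodic_mod:
  assumes "\<And>n. f (n - int m) = f n"
  shows "f (n mod int m) = f n"
proof -
  have "f (n - int m * k) = f n" for k
  proof (induction k rule: int_induct[where k = 0])
    case (step1 k)
    then show ?case
      using assms[of "n - int m * k"] by (simp add: algebra_simps)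
  next
    case (step2 k)
    then show ?case
      using assms[of "n - int m * (k - 1)"] by (simp add: algebra_simps)
  qed simp
  then show ?thesis
    unfolding minus_mult_div_eq_mod [symmetric] .
qed

lemma y_var_eq_variable: "y_var m j n = variable (j, n mod int m)"
  by (simp add: y_var_def variable_def)

lemma y_var_minus: "y_var m j (n - int m) = y_var m j n"
  by (simp add: y_var_def)

lemma F_mon_minus: "F_mon t m i (n - int m) = F_mon t m i n"
proof -
  have "y_var m j (n - int m + 1) = y_var m j (n + 1)" for j
    using y_var_minus[of m j "n + 1"] by (simp add: algebra_simps)
  then show ?thesis
    by (simp add: F_mon_def y_var_minus)
qed

text \<open>Setting every \<open>y\<^sub>i(n)\<close> to \<open>a\<close> and the other variables to 1 shows, for \<open>a = 1\<close>, that
  \<open>P\<^sub>i(n)\<close> does not vanish and, for \<open>a = 2\<close>, that the product of the \<open>X\<^sub>i(n)\<close> is not 1.\<close>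

lemma evaluation_substitution: "substitution (\<lambda>c :: complex. c)"
  by standard simp_all

context
  fixes i :: nat and a :: complex
  assumes a_nonzero: "a \<noteq> 0"
begin

interpretation ev: substitution "\<lambda>c. c" "\<lambda>v :: nat \<times> int. if fst v = i then a else (1 :: complex)"
  by (rule evaluation_substitution)

lemma evaluation_y_var: "ev.specializes (y_var m j n) (if j = i then a else 1)"
  using ev.specializes_variable[of "(j, n mod int m)"] by (simp add: y_var_def)

lemma evaluation_y_var_self: "ev.specializes (y_var m i n) a"
  using evaluation_y_var[of m i n] by simp

lemma evaluation_y_var_other: "j \<noteq> i \<Longrightarrow> ev.specializes (y_var m j n) 1"
  using evaluation_y_var[of m j n] by simp

text \<open>\<open>F_mon\<close> contains only variables of nodes different from \<open>i\<close>,
  and all of these are set to 1.\<close>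

lemma evaluation_F_mon: "ev.specializes (F_mon t m i n) 1"
proof -
  have "ev.specializes (F_mon t m i n)
      ((\<Prod>j | j \<in> nodes t \<and> j < i \<and> cartan t i j \<noteq> 0. 1) *
       (\<Prod>j | j \<in> nodes t \<and> j > i \<and> cartan t i j \<noteq> 0. 1))"
    unfolding F_mon_def
    by (intro ev.specializes_mult ev.specializes_prod evaluation_y_var_other) auto
  then show ?thesis
    by simp
qed

lemma evaluation_X_mon: "ev.specializes (X_mon t m i n) (1 / (a * a))"
  unfolding X_mon_def
  by (intro ev.specializes_divide ev.specializes_mult evaluation_F_mon evaluation_y_var_self)
    (simp add: a_nonzero)

lemma evaluation_cyclic_prod: "ev.specializes (cyclic_prod m (X_mon t m i) n) ((1 / (a * a)) ^ m)"
  using ev.specializes_prod[of "{..<m}" "\<lambda>s. X_mon t m i (n - int s)" "\<lambda>_. 1 / (a * a)"]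
  by (simp add: cyclic_prod_def evaluation_X_mon power_divide)

lemma evaluation_partial_prod_sum:
  "ev.specializes (partial_prod_sum m (X_mon t m i) n) (\<Sum>k<m. (1 / (a * a)) ^ k)"
proof -
  have "ev.specializes (\<Prod>s<k. X_mon t m i (n - int s)) ((1 / (a * a)) ^ k)" for k
    using ev.specializes_prod[of "{..<k}" "\<lambda>s. X_mon t m i (n - int s)" "\<lambda>_. 1 / (a * a)"]
    by (simp add: evaluation_X_mon power_divide)
  then show ?thesis
    unfolding partial_prod_sum_def by (rule ev.specializes_sum)
qed

lemma y_var_nonzero: "y_var m j n \<noteq> 0"
  using evaluation_y_var by (rule ev.specializes_nonzero) (simp add: a_nonzero)

lemma cyclic_prod_not_one:
  assumes "(1 / (a * a)) ^ m \<noteq> 1"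
  shows "cyclic_prod m (X_mon t m i) n \<noteq> 1"
proof
  assume "cyclic_prod m (X_mon t m i) n = 1"
  then have "ev.specializes 1 ((1 / (a * a)) ^ m)"
    using evaluation_cyclic_prod by metis
  with assms show False
    using ev.specializes_one ev.specializes_unique by blast
qed

lemma partial_prod_sum_nonzero:
  assumes "(\<Sum>k<m. (1 / (a * a)) ^ k) \<noteq> 0"
  shows "partial_prod_sum m (X_mon t m i) n \<noteq> 0"
  using evaluation_partial_prod_sum assms by (rule ev.specializes_nonzero)

end

lemma F_mon_nonzero: "F_mon t m i n \<noteq> 0"
  using y_var_nonzero[OF one_neq_zero] by (simp add: F_mon_def nodes_def)

lemma P_sum_eq_partial_prod_sum:
  assumes "m > 1"
  shows "P_sum t m i n = partial_prod_sum m (X_mon t m i) n"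
proof -
  \<comment> \<open>The bound \<open>m - 2\<close> is a natural number subtraction, exact since
    \<open>m > 1\<close>.\<close>
  define l where "l = m - 2"
  with assms have m: "m = Suc (Suc l)" by simp
  have "partial_prod_sum m (X_mon t m i) n = 1 + (\<Sum>k<Suc l. \<Prod>s<Suc k. X_mon t m i (n - int s))"
    unfolding partial_prod_sum_def m by (subst sum.lessThan_Suc_shift) simp
  also have "\<dots> = P_sum t m i n"
    unfolding P_sum_def l_def[symmetric] lessThan_Suc_atMost atMost_atLeast0 ..
  finally show ?thesis ..
qed

section \<open>The reflection at a fixed node\<close>

locale dynkin_node =
  fixes t :: dynkin and m i :: nat
  assumes m_gt_1: "m > 1" and node: "i \<in> nodes t"
begin

sublocale cyclic_system m "y_var m i" "F_mon t m i"
proof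
  show "m > 0"
    using m_gt_1 by simp
  show "y_var m i n \<noteq> 0" for n
    by (rule y_var_nonzero[OF one_neq_zero])
qed (fact y_var_minus, fact F_mon_minus, fact F_mon_nonzero)

lemma x_eq_X_mon: "x = X_mon t m i"
  by (simp add: fun_eq_iff x_def X_mon_def)

sublocale reflected_system m "y_var m i" "F_mon t m i"
proof
  show "P n \<noteq> 0" for n
  proof -
    \<comment> \<open>At \<open>a = 1\<close> every \<open>X\<close> becomes 1, so
      \<open>P n\<close> takes the value \<open>m\<close>, which is nonzero in characteristic
      0.\<close>
    have "(\<Sum>k<m. (1 / (1 * 1)) ^ k) = (of_nat m :: complex)"
      by simp
    moreover have "of_nat m \<noteq> (0 :: complex)"
      using m_gt_1 by simp
    ultimately show ?thesis
      unfolding P_def x_eq_X_mon by (intro partial_prod_sum_nonzero[OF one_neq_zero]) argo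
  qed
  show "Q \<noteq> 1"
  proof -
    have "norm ((1 / (2 * 2)) ^ m :: complex) = (1 / 4) ^ m"
      by (simp add: norm_power norm_divide)
    moreover have "(1 / 4 :: real) ^ m < 1"
      by (rule power_less_one_iff[THEN iffD2]) (use m_gt_1 in simp_all)
    ultimately have "(1 / (2 * 2)) ^ m \<noteq> (1 :: complex)"
      by (metis norm_one less_irrefl)
    then show ?thesis
      unfolding Q_def x_eq_X_mon by (rule cyclic_prod_not_one[rotated]) simp
  qed
qed


lemma ry_periodic: "ry (n - int m) = ry n"
  using P_periodic[of "n - 2"] P_periodic[of "n - 1"] x_periodic[of "n - 1"] y_periodic[of n]
  by (simp add: ry_def algebra_simps)

text \<open>The index type allows every integer, but \<open>y_var\<close> uses only the
  representatives below \<open>m\<close>. All remaining variables are fixed, so that the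
  substitution is an involution of the whole ambient field.\<close>

definition reflected_variable :: "nat \<times> int \<Rightarrow> ratfun" where
  "reflected_variable v = (if fst v = i \<and> snd v \<in> {0..<int m} then ry (snd v) else variable v)"

sublocale sub: substitution const_fun reflected_variable
  by standard (simp_all add: const_fun_add const_fun_mult)

lemma specializes_y: "sub.specializes (y_var m i n) (ry n)"
proof -
  have "reflected_variable (i, n mod int m) = ry n"
    using m_gt_1 periodic_mod[of ry m n] by (simp add: reflected_variable_def ry_periodic)
  then show ?thesis
    using sub.specializes_variable[of "(i, n mod int m)"] by (simp add: y_var_def)
qed

lemma specializes_y_other: "j \<noteq> i \<Longrightarrow> sub.specializes (y_var m j n) (y_var m j n)"
  using sub.specializes_variable[of "(j, n mod int m)"]
  by (simp add: y_var_def reflected_variable_def variable_def)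

lemma specializes_F: "sub.specializes (F_mon t m i n) (F_mon t m i n)"
  unfolding F_mon_def
  by (intro sub.specializes_mult sub.specializes_prod specializes_y_other) auto

lemma specializes_x: "sub.specializes (x n) (rx n)"
  unfolding x_def rx_def
  by (intro sub.specializes_divide sub.specializes_mult specializes_F specializes_y)
    (simp add: ry_nonzero)

lemma specializes_P: "sub.specializes (P n) (partial_prod_sum m rx n)"
  unfolding P_def partial_prod_sum_def
  by (intro sub.specializes_sum sub.specializes_prod specializes_x)

text \<open>Each ingredient of \<open>ry\<close> specializes to its reflected counterpart, which
  produces the left side of \<open>ry_involution\<close>. The denominator stays nonzero by
  \<open>partial_prod_sum_rx\<close>.\<close>

lemma specializes_ry: "sub.specializes (ry n) (y_var m i n)"
proof -
  have "partial_prod_sum m rx (n - 1) \<noteq> 0"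
    by (simp add: partial_prod_sum_rx P_nonzero x_nonzero Q_nonzero)
  then have "sub.specializes (ry n)
      (partial_prod_sum m rx (n - 2) / partial_prod_sum m rx (n - 1) * ry n * rx (n - 1))"
    unfolding ry_def[of n]
    by (intro sub.specializes_mult sub.specializes_divide specializes_P specializes_x
        specializes_y[unfolded ry_def])
  then show ?thesis
    unfolding ry_involution .
qed

sublocale refl: involutive_substitution const_fun reflected_variable
proof
  show "const_fun a = Fraction_Field.Fract (Poly_Mapping.single 0 a) 1" for a
    by (rule const_fun_def)
  show "sub.specializes (reflected_variable v) (variable v)" for v
  proof (cases "fst v = i \<and> snd v \<in> {0..<int m}")
    case True
    then have "variable v = y_var m i (snd v)"
      by (cases v) (simp add: y_var_eq_variable)
    with True specializes_ry show ?thesis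
      by (simp add: reflected_variable_def)
  next
    case False
    then have "reflected_variable v = variable v"
      unfolding reflected_variable_def by (rule if_not_P)
    then show ?thesis
      using sub.specializes_variable[of v] by (simp add: variable_def)
  qed
qed

lemma extension_y: "refl.extension (y_var m i n) = ry n"
  by (rule refl.extension_eq[OF specializes_y])

lemma extension_y_other: "j \<noteq> i \<Longrightarrow> refl.extension (y_var m j n) = y_var m j n"
  by (rule refl.extension_eq[OF specializes_y_other])

lemma extension_F: "refl.extension (F_mon t m i n) = F_mon t m i n"
  by (rule refl.extension_eq[OF specializes_F])

lemma extension_z: "refl.extension (z_elt t m i n) = z_elt t m i n"
  unfolding z_elt_def by (simp add: extension_y extension_F ry_z)

lemma y_in_Y: "j \<in> nodes t \<Longrightarrow> y_var m j n \<in> Y_field t m"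
  unfolding Y_field_def by (rule adjoin_incl) blast

lemma F_in_Y: "F_mon t m i n \<in> Y_field t m"
  using y_in_Y unfolding F_mon_def Y_field_def by (intro adjoin_mult adjoin_prod) auto

lemma x_in_Y: "x n \<in> Y_field t m"
  using y_in_Y[OF node] F_in_Y unfolding x_def Y_field_def by (intro adjoin_divide adjoin_mult)

lemma P_in_Y: "P n \<in> Y_field t m"
  using x_in_Y unfolding P_def partial_prod_sum_def Y_field_def by (intro adjoin_sum adjoin_prod)

lemma ry_in_Y: "ry n \<in> Y_field t m"
  using x_in_Y P_in_Y y_in_Y[OF node] unfolding ry_def Y_field_def
  by (intro adjoin_mult adjoin_divide)

lemma extension_in_Y:
  assumes "u \<in> Y_field t m"
  shows "refl.extension u \<in> Y_field t m"
proof -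
  have "u \<in> adjoin {y_var m j n | j n. j \<in> nodes t}"
    using assms by (simp add: Y_field_def)
  then have "refl.extension u \<in> adjoin {y_var m j n | j n. j \<in> nodes t}"
  proof (induction rule: adjoin_induct)
    case (incl u)
    then obtain j n where "u = y_var m j n" "j \<in> nodes t" by blast
    then have "refl.extension u \<in> Y_field t m"
      using extension_y extension_y_other ry_in_Y y_in_Y by (cases "j = i") simp_all
    then show ?case
      by (simp add: Y_field_def)
  qed auto
  then show ?thesis
    by (simp add: Y_field_def)
qed

text \<open>Bijectivity holds because the extension is its own inverse.\<close>

lemma algebra_aut_extension: "algebra_aut t m (restrict refl.extension (Y_field t m))"
proof -
  let ?R = "ring_of_type_algebra\<lparr>carrier := Y_field t m\<rparr>"
  have const: "const_fun c \<in> Y_field t m" for c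
    by (simp add: Y_field_def)
  have closed: "u + v \<in> Y_field t m" "u * v \<in> Y_field t m" "1 \<in> Y_field t m"
    if "u \<in> Y_field t m" "v \<in> Y_field t m" for u v
    using that by (auto simp: Y_field_def)
  have one: "1 \<in> Y_field t m"
    by (simp add: Y_field_def)
  have "restrict refl.extension (Y_field t m) \<in> ring_hom ?R ?R"
    by (rule ring_hom_memI) (simp_all add: extension_in_Y closed one)
  moreover have "bij_betw (restrict refl.extension (Y_field t m)) (Y_field t m) (Y_field t m)"
    by (rule bij_betwI[where g = refl.extension]) (auto simp: extension_in_Y)
  ultimately show ?thesis
    by (simp add: algebra_aut_def ring_iso_def const)
qed

end

text \<open>Agreement spreads from the generators through all field operations. This gives the
  uniqueness that the description in \<open>r_aut\<close> requires.\<close>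

lemma algebra_aut_unique:
  assumes "algebra_aut t m f" "algebra_aut t m g"
    and "\<And>j n. j \<in> nodes t \<Longrightarrow> f (y_var m j n) = g (y_var m j n)"
  shows "f = g"
proof (rule extensionalityI)
  let ?S = "{y_var m j n | j n. j \<in> nodes t}"
  let ?R = "ring_of_type_algebra\<lparr>carrier := Y_field t m\<rparr>"
  show "f \<in> extensional (Y_field t m)" "g \<in> extensional (Y_field t m)"
    using assms(1,2) by (simp_all add: algebra_aut_def)
  have hom: "h (u + v) = h u + h v" "h (u * v) = h u * h v"
    if "algebra_aut t m h" "u \<in> adjoin ?S" "v \<in> adjoin ?S" for h u v
  proof -
    have "h \<in> ring_hom ?R ?R"
      using that(1) by (simp add: algebra_aut_def ring_iso_def)
    from ring_hom_add[OF this, of u v] ring_hom_mult[OF this, of u v] that(2,3)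
    show "h (u + v) = h u + h v" "h (u * v) = h u * h v"
      by (simp_all add: Y_field_def)
  qed
  have const: "h (const_fun c) = const_fun c" if "algebra_aut t m h" for h c
    using that by (simp add: algebra_aut_def)
  \<comment> \<open>\<open>h 0 = 0\<close> and, below, \<open>h 1 = 1\<close> are instances of
    \<open>h\<close> fixing the constants.\<close>
  have uminus: "h (- u) = - h u" if "algebra_aut t m h" "u \<in> adjoin ?S" for h u
  proof -
    have "h u + h (- u) = h 0"
      using that hom(1)[OF that(1), of u "- u"] by (simp add: adjoin_uminus)
    then show ?thesis
      using const[OF that(1), of 0] by (simp add: eq_neg_iff_add_eq_0 add.commute)
  qed
  have inverse: "h (inverse u) = inverse (h u)"
    if "algebra_aut t m h" "u \<in> adjoin ?S" "u \<noteq> 0" for h u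
  proof -
    have "h u * h (inverse u) = h 1"
      using that hom(2)[OF that(1), of u "inverse u"] by (simp add: adjoin_inverse)
    then show ?thesis
      using const[OF that(1), of 1] by (simp add: inverse_unique)
  qed
  show "f u = g u" if "u \<in> Y_field t m" for u
    using that unfolding Y_field_def
  proof (induction rule: adjoin_induct)
    case (incl u)
    then show ?case using assms(3) by blast
  qed (simp_all add: hom uminus inverse const assms(1,2))
qed

context dynkin_node
begin

lemma r_aut_eq: "r_aut t m i = restrict refl.extension (Y_field t m)"
proof -
  let ?f = "restrict refl.extension (Y_field t m)"
  let ?C = "\<lambda>f. algebra_aut t m f \<and>
    (\<forall>n. f (y_var m i n) =
      P_sum t m i (n - 2) / P_sum t m i (n - 1) * y_var m i n * X_mon t m i (n - 1)) \<and>
    (\<forall>j \<in> nodes t - {i}. \<forall>n. f (y_var m j n) = y_var m j n)"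
  have f: "?C ?f"
    by (simp add: algebra_aut_extension y_in_Y node extension_y extension_y_other ry_def P_def x_eq_X_mon
        P_sum_eq_partial_prod_sum[OF m_gt_1])
  moreover have "g = ?f" if "?C g" for g
  proof (rule algebra_aut_unique[of t m])
    show "g (y_var m j n) = ?f (y_var m j n)" if "j \<in> nodes t" for j n
      using \<open>?C g\<close> f that by (cases "j = i") simp_all
  qed (use that f in blast)+
  ultimately show ?thesis
    unfolding r_aut_def by (rule the_equality)
qed


section \<open>The invariants of a simple reflection\<close>

lemma Z_const: "const_fun c \<in> Z_field t m i"
  and Z_zero: "0 \<in> Z_field t m i"
  and Z_one: "1 \<in> Z_field t m i"
  by (simp_all add: Z_field_def)

lemma Z_add: "u \<in> Z_field t m i \<Longrightarrow> v \<in> Z_field t m i \<Longrightarrow> u + v \<in> Z_field t m i"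
  and Z_diff: "u \<in> Z_field t m i \<Longrightarrow> v \<in> Z_field t m i \<Longrightarrow> u - v \<in> Z_field t m i"
  and Z_mult: "u \<in> Z_field t m i \<Longrightarrow> v \<in> Z_field t m i \<Longrightarrow> u * v \<in> Z_field t m i"
  and Z_divide: "u \<in> Z_field t m i \<Longrightarrow> v \<in> Z_field t m i \<Longrightarrow> u / v \<in> Z_field t m i"
  and Z_uminus: "u \<in> Z_field t m i \<Longrightarrow> - u \<in> Z_field t m i"
  unfolding Z_field_def by auto

lemma z_in_Z: "z_elt t m i n \<in> Z_field t m i"
  unfolding Z_field_def by (rule adjoin_incl) blast

lemma y_in_Z: "j \<in> nodes t \<Longrightarrow> j \<noteq> i \<Longrightarrow> y_var m j n \<in> Z_field t m i"
  unfolding Z_field_def by (rule adjoin_incl) blast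

lemma F_in_Z: "F_mon t m i n \<in> Z_field t m i"
proof -
  have "y_var m j k \<in> adjoin ({z_elt t m i n | n. True} \<union> {y_var m j n | j n. j \<in> nodes t - {i}})"
    if "j \<in> nodes t" "j \<noteq> i" for j k
    using y_in_Z[OF that] by (simp add: Z_field_def)
  then show ?thesis
    unfolding F_mon_def Z_field_def by (intro adjoin_mult adjoin_prod) auto
qed

lemma Z_subset_Y: "Z_field t m i \<subseteq> Y_field t m"
proof -
  have "z_elt t m i n \<in> Y_field t m" for n
    using y_in_Y[OF node] F_in_Y unfolding z_elt_def Y_field_def by (intro adjoin_add adjoin_divide)
  then show ?thesis
    using y_in_Y unfolding Z_field_def Y_field_def by (intro adjoin_subset) auto
qed

lemma extension_Z: "u \<in> Z_field t m i \<Longrightarrow> refl.extension u = u"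
  unfolding Z_field_def
  by (induction rule: adjoin_induct) (auto simp: extension_z extension_y_other)

section \<open>\<open>Y_field\<close> as a quadratic extension of \<open>Z_field\<close>, generated
  by \<open>\<Lambda>\<close>\<close>

definition \<Lambda> :: ratfun where "\<Lambda> = cyclic_prod m (y_var m i) 0"

lemma extension_\<Lambda>: "refl.extension \<Lambda> = Q * \<Lambda>"
proof -
  have "refl.extension \<Lambda> = cyclic_prod m ry 0"
    by (simp add: \<Lambda>_def cyclic_prod_def refl.extension_prod extension_y)
  then show ?thesis
    by (simp add: cyclic_prod_ry \<Lambda>_def)
qed

lemma extension_\<Lambda>_neq: "refl.extension \<Lambda> \<noteq> \<Lambda>"
proof -
  have "\<Lambda> \<noteq> 0"
    by (simp add: \<Lambda>_def cyclic_prod_def y_nonzero)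
  then show ?thesis
    using Q_not_one by (simp add: extension_\<Lambda>)
qed

text \<open>The relation \<open>y(k) y(k+1) = z(k) y(k+1) - F(k)\<close> makes \<open>(y(0), 1)\<close> proportional to the image of
  \<open>(y(k), 1)\<close> under a product of matrices with entries in \<open>Z_field\<close>.  For \<open>k = m\<close> it becomes an
  eigenvector, with eigenvalue \<open>\<Lambda>\<close>.\<close>

lemma transfer_matrix:
  "\<exists>a\<in>Z_field t m i. \<exists>b\<in>Z_field t m i. \<exists>c\<in>Z_field t m i. \<exists>d\<in>Z_field t m i.
     a * y_var m i (int k) + b = (\<Prod>s<k. y_var m i (int s + 1)) * y_var m i 0 \<and>
     c * y_var m i (int k) + d = (\<Prod>s<k. y_var m i (int s + 1))"
proof (induction k)
  case 0
  have "1 * y_var m i 0 + 0 = y_var m i 0" "0 * y_var m i 0 + 1 = 1"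
    by simp_all
  then show ?case
    using Z_zero Z_one by force
next
  case (Suc k)
  define pr where "pr k = (\<Prod>s<k. y_var m i (int s + 1))" for k
  define u v where "u = y_var m i (int k)" and "v = y_var m i (int k + 1)"
  have pr: "pr (Suc k) = pr k * v"
    by (simp add: pr_def v_def)
  \<comment> \<open>By \<open>u * v = z * v - F\<close>, the row \<open>(p, q)\<close> is multiplied
    on the right by the matrix with rows \<open>(z, - F)\<close> and \<open>(1, 0)\<close>.\<close>
  have step: "(p * u + q) * v = (p * z_elt t m i (int k) + q) * v + - (p * F_mon t m i (int k))" for p q
    using y_nonzero[of "int k + 1"] by (simp add: z_elt_def u_def v_def algebra_simps)
  obtain a b c d where *: "a \<in> Z_field t m i" "b \<in> Z_field t m i" "c \<in> Z_field t m i" "d \<in> Z_field t m i"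
      "a * u + b = pr k * y_var m i 0" "c * u + d = pr k"
    using Suc.IH unfolding pr_def u_def by blast
  let ?z = "z_elt t m i (int k)" and ?F = "F_mon t m i (int k)"
  have "(a * ?z + b) * v + - (a * ?F) = pr (Suc k) * y_var m i 0"
    unfolding step[symmetric] *(5) pr by (simp add: ac_simps)
  moreover have "(c * ?z + d) * v + - (c * ?F) = pr (Suc k)"
    unfolding step[symmetric] *(6) pr ..
  moreover have "a * ?z + b \<in> Z_field t m i" "- (a * ?F) \<in> Z_field t m i"
      "c * ?z + d \<in> Z_field t m i" "- (c * ?F) \<in> Z_field t m i"
    by (intro Z_add Z_mult Z_uminus z_in_Z F_in_Z *)+
  ultimately show ?case
    unfolding pr_def v_def of_nat_Suc add.commute[of 1] by blast
qed

text \<open>Eliminating \<open>y(0)\<close> from the two eigenvector equations yields the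
  characteristic equation of the transfer matrix, with trace \<open>T\<close> and determinant
  \<open>N\<close>.\<close>

lemma quadratic_extension:
  obtains T N c d where "T \<in> Z_field t m i" "N \<in> Z_field t m i" "c \<in> Z_field t m i" "d \<in> Z_field t m i"
    "\<Lambda> * \<Lambda> = T * \<Lambda> - N" "refl.extension \<Lambda> = T - \<Lambda>" "y_var m i 0 = (\<Lambda> - d) / c"
proof -
  \<comment> \<open>The cyclic product based at \<open>m\<close> runs through
    \<open>y(m), ..., y(1)\<close>, the factors collected by the transfer matrices in reverse
    order.\<close>
  have "cyclic_prod m (y_var m i) (int m) = (\<Prod>s<m. y_var m i (int (m - Suc s) + 1))"
    unfolding cyclic_prod_def by (rule prod.cong) (auto)
  also have "\<dots> = (\<Prod>s<m. y_var m i (int s + 1))"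
    by (rule prod.nat_diff_reindex)
  finally have \<Lambda>: "(\<Prod>s<m. y_var m i (int s + 1)) = \<Lambda>"
    using cyclic_prod_const[of m "y_var m i" "int m"] m_pos y_periodic by (simp add: \<Lambda>_def)
  have "y_var m i (int m) = y_var m i 0"
    using y_periodic[of "int m"] by simp
  then obtain a b c d where Z: "a \<in> Z_field t m i" "b \<in> Z_field t m i" "c \<in> Z_field t m i" "d \<in> Z_field t m i"
    and ab: "a * y_var m i 0 + b = \<Lambda> * y_var m i 0" and cd: "c * y_var m i 0 + d = \<Lambda>"
    using transfer_matrix[of m] unfolding \<Lambda> by metis
  have "c \<noteq> 0"
  proof
    assume "c = 0"
    with cd Z(4) have "\<Lambda> \<in> Z_field t m i" by simp
    with extension_Z extension_\<Lambda>_neq show False by blast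
  qed
  with cd have y: "y_var m i 0 = (\<Lambda> - d) / c"
    by (simp add: field_simps)
  have "b = (\<Lambda> - a) * y_var m i 0"
    using ab by (simp add: algebra_simps)
  then have "(\<Lambda> - a) * (c * y_var m i 0) = b * c"
    by (simp add: ac_simps)
  moreover have "c * y_var m i 0 = \<Lambda> - d"
    using cd by (simp add: algebra_simps)
  ultimately have quad: "\<Lambda> * \<Lambda> = (a + d) * \<Lambda> - (a * d - b * c)"
    by (simp add: algebra_simps)
  define T N where "T = a + d" and "N = a * d - b * c"
  let ?\<Lambda>' = "refl.extension \<Lambda>"
  have TN: "T \<in> Z_field t m i" "N \<in> Z_field t m i"
    unfolding T_def N_def by (intro Z_add Z_diff Z_mult Z)+
  note quad = quad[folded T_def N_def]
  \<comment> \<open>\<open>T\<close> and \<open>N\<close> are fixed, so the image of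
    \<open>\<Lambda>\<close> is again a root of the quadratic. Being different from
    \<open>\<Lambda>\<close>, it is the other root.\<close>
  have "refl.extension (\<Lambda> * \<Lambda> + N) = refl.extension (T * \<Lambda>)"
    using quad by simp
  then have quad': "?\<Lambda>' * ?\<Lambda>' = T * ?\<Lambda>' - N"
    by (simp add: extension_Z TN eq_diff_eq)
  have "(?\<Lambda>' - \<Lambda>) * (?\<Lambda>' - (T - \<Lambda>)) = (?\<Lambda>' * ?\<Lambda>' - T * ?\<Lambda>') - (\<Lambda> * \<Lambda> - T * \<Lambda>)"
    by (simp add: algebra_simps)
  also have "\<dots> = 0"
    unfolding quad quad' by simp
  finally have "(?\<Lambda>' - \<Lambda>) * (?\<Lambda>' - (T - \<Lambda>)) = 0" .
  with extension_\<Lambda>_neq have "?\<Lambda>' = T - \<Lambda>"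
    by simp
  from that[OF TN Z(3,4) quad this y] show thesis .
qed

text \<open>The set \<open>E\<close> of all \<open>p + q * \<Lambda>\<close> is closed under the
  field operations and contains the generators of \<open>Y_field\<close>.\<close>

lemma Y_decomposition:
  assumes "u \<in> Y_field t m"
  shows "\<exists>p\<in>Z_field t m i. \<exists>q\<in>Z_field t m i. u = p + q * \<Lambda>"
proof -
  obtain T N c d where Z: "T \<in> Z_field t m i" "N \<in> Z_field t m i" "c \<in> Z_field t m i" "d \<in> Z_field t m i"
    and quad: "\<Lambda> * \<Lambda> = T * \<Lambda> - N" and conj: "refl.extension \<Lambda> = T - \<Lambda>"
    and y0: "y_var m i 0 = (\<Lambda> - d) / c"
    by (rule quadratic_extension)
  define E where "E = {p + q * \<Lambda> | p q. p \<in> Z_field t m i \<and> q \<in> Z_field t m i}"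
  have EI: "p + q * \<Lambda> \<in> E" if "p \<in> Z_field t m i" "q \<in> Z_field t m i" for p q
    using that unfolding E_def by blast
  have EE: "\<exists>p q. p \<in> Z_field t m i \<and> q \<in> Z_field t m i \<and> u = p + q * \<Lambda>" if "u \<in> E" for u
    using that unfolding E_def by blast
  have Z_E: "p \<in> E" if "p \<in> Z_field t m i" for p
    using EI[OF that Z_zero] by simp
  have E_add: "u + v \<in> E" if uv: "u \<in> E" "v \<in> E" for u v
  proof -
    obtain p q p' q' where *: "p \<in> Z_field t m i" "q \<in> Z_field t m i" "p' \<in> Z_field t m i" "q' \<in> Z_field t m i"
      and "u = p + q * \<Lambda>" "v = p' + q' * \<Lambda>"
      using EE[OF uv(1)] EE[OF uv(2)] by blast
    then have "u + v = (p + p') + (q + q') * \<Lambda>"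
      by (simp add: algebra_simps)
    with EI[OF Z_add[OF *(1,3)] Z_add[OF *(2,4)]] show ?thesis by simp
  qed
  have E_mult: "u * v \<in> E" if uv: "u \<in> E" "v \<in> E" for u v
  proof -
    obtain p q p' q' where *: "p \<in> Z_field t m i" "q \<in> Z_field t m i" "p' \<in> Z_field t m i" "q' \<in> Z_field t m i"
      and "u = p + q * \<Lambda>" "v = p' + q' * \<Lambda>"
      using EE[OF uv(1)] EE[OF uv(2)] by blast
    then have "u * v = p * p' + (p * q' + q * p') * \<Lambda> + q * q' * (\<Lambda> * \<Lambda>)"
      by (simp add: algebra_simps)
    also have "\<dots> = (p * p' - q * q' * N) + (p * q' + q * p' + q * q' * T) * \<Lambda>"
      unfolding quad by (simp add: algebra_simps)
    also have "\<dots> \<in> E"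
      by (intro EI Z_add Z_diff Z_mult Z *)
    finally show ?thesis .
  qed
  have E_uminus: "- u \<in> E" if "u \<in> E" for u
    using E_mult[OF Z_E[OF Z_uminus[OF Z_one]] that] by simp
  have E_inverse: "inverse u \<in> E" if u: "u \<in> E" for u
  proof (cases "u = 0")
    case False
    obtain p q where *: "p \<in> Z_field t m i" "q \<in> Z_field t m i" and u_eq: "u = p + q * \<Lambda>"
      using EE[OF u] by blast
    have ext: "refl.extension u = (p + q * T) - q * \<Lambda>"
      unfolding u_eq by (simp add: extension_Z * conj algebra_simps)
    \<comment> \<open>\<open>D\<close> is the norm of \<open>u\<close>, the product of
      \<open>u\<close> with its conjugate; it lies in \<open>Z_field\<close>, so the denominator can
      be rationalised.\<close>
    define D where "D = p * p + p * q * T + q * q * N"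
    have "u * refl.extension u = p * p + p * q * T + q * q * (T * \<Lambda> - \<Lambda> * \<Lambda>)"
      unfolding ext by (simp add: u_eq algebra_simps)
    also have "\<dots> = D"
      unfolding quad by (simp add: D_def)
    finally have D: "u * refl.extension u = D" .
    moreover have "refl.extension u \<noteq> 0"
      using False by simp
    ultimately have "inverse u = refl.extension u / D"
      using False by (auto simp: field_simps)
    also have "\<dots> = (p + q * T) / D + (- q / D) * \<Lambda>"
      unfolding ext by (simp add: diff_divide_distrib)
    also have "\<dots> \<in> E"
      unfolding D_def by (intro EI Z_divide Z_add Z_mult Z_uminus Z *)
    finally show ?thesis .
  qed (use Z_E Z_zero in simp)
  \<comment> \<open>Only \<open>y(0)\<close> is known to be affine in \<open>\<Lambda>\<close>. The
    other \<open>y(k)\<close> follow from \<open>y(k+1) = F(k) / (z(k) - y(k))\<close>, since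
    \<open>E\<close> is closed under inverses.\<close>
  have y_E: "y_var m i (int k) \<in> E" for k
  proof (induction k)
    case 0
    have "(- d / c) + (1 / c) * \<Lambda> \<in> E"
      by (intro EI Z_divide Z_uminus Z Z_one)
    then show ?case
      by (simp add: y0 diff_divide_distrib)
  next
    case (Suc k)
    let ?z = "z_elt t m i (int k)" and ?F = "F_mon t m i (int k)"
    have "?z - y_var m i (int k) = ?F / y_var m i (int k + 1)"
      by (simp add: z_elt_def)
    then have "?z - y_var m i (int k) \<noteq> 0" "?F = (?z - y_var m i (int k)) * y_var m i (int k + 1)"
      by (simp_all add: F_nonzero y_nonzero)
    then have "y_var m i (int k + 1) = ?F * inverse (?z + - y_var m i (int k))"
      by simp
    also have "\<dots> \<in> E"
      by (intro E_mult E_inverse E_add E_uminus Suc.IH Z_E F_in_Z z_in_Z)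
    finally show ?case
      by (simp add: add.commute)
  qed
  have "u \<in> adjoin {y_var m j n | j n. j \<in> nodes t}"
    using assms by (simp add: Y_field_def)
  then have "u \<in> E"
  proof (induction rule: adjoin_induct)
    case (incl u)
    then obtain j n where jn: "u = y_var m j n" "j \<in> nodes t" by blast
    show ?case
    proof (cases "j = i")
      case True
      have "y_var m i n = y_var m i (int (nat (n mod int m)))"
        using m_gt_1 by (simp add: y_var_def)
      with y_E jn(1) True show ?thesis by metis
    next
      case False
      with jn y_in_Z Z_E show ?thesis by simp
    qed
  qed (use E_add E_mult E_uminus E_inverse Z_E Z_const in blast)+
  then show ?thesis
    unfolding E_def by blast
qed

lemma invariants_r_aut: "invariants (Y_field t m) (r_aut t m) i = Z_field t m i"
proof (intro subset_antisym subsetI)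
  fix u
  assume "u \<in> invariants (Y_field t m) (r_aut t m) i"
  then have u: "u \<in> Y_field t m" "refl.extension u = u"
    by (auto simp: invariants_def r_aut_eq)
  then obtain p q where pq: "p \<in> Z_field t m i" "q \<in> Z_field t m i" "u = p + q * \<Lambda>"
    using Y_decomposition by blast
  then have "q * refl.extension \<Lambda> = q * \<Lambda>"
    using u(2) by (simp add: extension_Z)
  then have "q = 0"
    using extension_\<Lambda>_neq by simp
  with pq show "u \<in> Z_field t m i" by simp
next
  fix u
  assume "u \<in> Z_field t m i"
  with Z_subset_Y extension_Z show "u \<in> invariants (Y_field t m) (r_aut t m) i"
    by (auto simp: invariants_def r_aut_eq)
qed

end


section \<open>Weyl group invariants\<close>

text \<open>\<open>subgroup_generated\<close> intersects the given generators with the carrier, so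
  the simple reflections must be shown to lie in it. Each one is its own inverse.\<close>

lemma simple_reflection_in_Bij:
  assumes i: "i \<in> nodes t"
  shows "simple_reflection t i \<in> Bij (cartan_dual t)"
proof -
  define S where "S v = (\<Sum>k\<in>nodes t. of_int (cartan t i k) * v k)" for v :: "nat \<Rightarrow> complex"
  let ?s = "simple_reflection t i"
  have s_apply: "?s v = (\<lambda>j\<in>nodes t. if j = i then v i - S v else v j)" if "v \<in> cartan_dual t" for v
    using that unfolding simple_reflection_def S_def by simp
  have s_closed: "?s v \<in> cartan_dual t" if "v \<in> cartan_dual t" for v
    unfolding s_apply[OF that] by (simp add: cartan_dual_def)
  have "?s (?s v) = v" if v: "v \<in> cartan_dual t" for v
  proof -
    have fin: "finite (nodes t)"
      by (simp add: nodes_def)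
    \<comment> \<open>Only coordinate \<open>i\<close> changes, by \<open>- S v\<close>, and it
      enters the sum with the diagonal Cartan entry 2.\<close>
    have "S (?s v) = (\<Sum>k\<in>nodes t. of_int (cartan t i k) * v k - (if k = i then 2 * S v else 0))"
      unfolding S_def[of "?s v"]
      by (rule sum.cong) (auto simp: s_apply[OF v] cartan_def algebra_simps)
    also have "\<dots> = S v - 2 * S v"
      unfolding sum_subtractf S_def[of v, symmetric] using fin i by simp
    finally have S: "S (?s v) = - S v" by simp
    show ?thesis
    proof
      fix j
      show "?s (?s v) j = v j"
        unfolding s_apply[OF s_closed[OF v]] S
        using v i by (auto simp: s_apply[OF v] cartan_dual_def PiE_def extensional_def)
    qed
  qed
  then have "bij_betw ?s (cartan_dual t) (cartan_dual t)"
    using s_closed by (intro bij_betwI[where g = ?s]) auto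
  then show ?thesis
    by (simp add: Bij_def simple_reflection_def)
qed

text \<open>An element fixed by all simple reflections is fixed by their inverses and by all
  products of these, hence by the whole generated group.\<close>

lemma weyl_invariants:
  assumes \<rho>: "weyl_action t m \<rho>" and "nodes t \<noteq> {}"
  shows "(\<Inter>w\<in>carrier (weyl_group t). invariants (Y_field t m) \<rho> w) =
    (\<Inter>i\<in>nodes t. invariants (Y_field t m) (r_aut t m) i)"
proof -
  let ?G = "BijGroup (cartan_dual t)" and ?S = "simple_reflection t ` nodes t"
  interpret G: group ?G
    by (rule group_BijGroup)
  interpret act: group_action "weyl_group t" "Y_field t m" \<rho>
    using \<rho> by (simp add: weyl_action_def)
  have S: "?S \<subseteq> carrier ?G"
    using simple_reflection_in_Bij by (auto simp: BijGroup_def)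
  then have carrier: "carrier (weyl_group t) = generate ?G ?S"
    by (simp add: weyl_group_def carrier_subgroup_generated Int_absorb1)
  have \<rho>_s: "\<rho> (simple_reflection t i) = r_aut t m i" if "i \<in> nodes t" for i
    using that \<rho> by (simp add: weyl_action_def)
  have s_carrier: "simple_reflection t i \<in> carrier (weyl_group t)" if "i \<in> nodes t" for i
    unfolding carrier using that by (auto intro: generate.incl)
  show ?thesis
  proof (intro subset_antisym subsetI INT_I)
    fix u i
    assume "u \<in> (\<Inter>w\<in>carrier (weyl_group t). invariants (Y_field t m) \<rho> w)" and i: "i \<in> nodes t"
    with s_carrier[OF i] show "u \<in> invariants (Y_field t m) (r_aut t m) i"
      unfolding invariants_def \<rho>_s[OF i, symmetric] by blast
  next
    fix u w
    assume u: "u \<in> (\<Inter>i\<in>nodes t. invariants (Y_field t m) (r_aut t m) i)"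
      and w: "w \<in> carrier (weyl_group t)"
    \<comment> \<open>An intersection over no nodes would be the whole type; any one node places
      \<open>u\<close> in \<open>Y_field\<close>.\<close>
    have u_Y: "u \<in> Y_field t m"
      using u \<open>nodes t \<noteq> {}\<close> by (auto simp: invariants_def)
    have fixed: "\<rho> s u = u" if "s \<in> ?S" for s
      using that u \<rho>_s by (auto simp: invariants_def)
    have "w \<in> generate ?G ?S"
      using w carrier by simp
    then have "\<rho> w u = u"
    proof (induction rule: generate.induct)
      case one
      have "\<one>\<^bsub>?G\<^esub> = \<one>\<^bsub>weyl_group t\<^esub>"
        by (simp add: weyl_group_def)
      then show ?case
        using act.id_eq_one u_Y by (metis restrict_apply')
    next
      case (incl s)
      then show ?case by (rule fixed)
    next
      case (inv s)
      have "s \<in> carrier (weyl_group t)"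
        using inv carrier by (simp add: generate.incl)
      moreover from this have "inv\<^bsub>weyl_group t\<^esub> s = inv\<^bsub>?G\<^esub> s"
        unfolding weyl_group_def by (rule G.inv_subgroup_generated)
      ultimately show ?case
        using act.orbit_sym_aux[OF _ u_Y fixed[OF inv]] by simp
    next
      case (eng g h)
      have "g \<otimes>\<^bsub>?G\<^esub> h = g \<otimes>\<^bsub>weyl_group t\<^esub> h"
        by (simp add: weyl_group_def)
      then show ?case
        using eng act.composition_rule[OF u_Y, of g h] carrier by simp
    qed
    with u_Y show "u \<in> invariants (Y_field t m) \<rho> w"
      by (simp add: invariants_def)
  qed
qed

theorem theorem3p1:
  fixes t :: dynkin and m :: nat
  assumes "valid_dynkin t" and "m > 1"
  shows "(\<forall>i \<in> nodes t. invariants (Y_field t m) (r_aut t m) i = Z_field t m i) \<and>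
    (\<forall>\<rho>. weyl_action t m \<rho> \<longrightarrow>
       (\<Inter>w \<in> carrier (weyl_group t). invariants (Y_field t m) \<rho> w) =
       (\<Inter>i \<in> nodes t. Z_field t m i))"
proof -
  have Z: "invariants (Y_field t m) (r_aut t m) i = Z_field t m i" if "i \<in> nodes t" for i
    by (rule dynkin_node.invariants_r_aut) (unfold_locales, fact assms, fact that)
  moreover have "nodes t \<noteq> {}"
    using assms(1) by (cases t) (auto simp: nodes_def)
  ultimately show ?thesis
    using weyl_invariants by simp
qed

end
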